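(* Let $p\ge 1$ and let $G=C_5^p$. Then $G$ is near graceful when $p\equiv 1,2 \pmod 4$ and $G$ is graceful when $p\equiv 0,3\pmod 4$.
   Context: $C_n^p$ denotes the graph obtained from the union of $p$ cycles of length $n$ sharing exactly one common vertex (the central vertex). For a graph $G$ with $m$ edges, a graceful labelling is an injective map $f:V(G)\to\{0,1,\ldots,m\}$ such that the induced edge labelling $g(uv)=|f(u)-f(v)|$ is a bijection onto $\{1,\ldots,m\}$. A near graceful labelling is an injective map $f:V(G)\to\{0,1,\ldots,m+1\}$ such that $g(uv)=|f(u)-f(v)|$ is a bijection onto $A$, where $A$ is $\{1,\ldots,m-1,m\}$ or $\{1,\ldots,m-1,m+1\}$. A graph is (near) graceful if it has a (near) graceful labelling. *)

theory Defs
  imports Main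
begin

type_synonym 'a ugraph = "'a set \<times> 'a set set"

abbreviation verts :: "'a ugraph \<Rightarrow> 'a set" where
  "verts G \<equiv> fst G"

abbreviation edges :: "'a ugraph \<Rightarrow> 'a set set" where
  "edges G \<equiv> snd G"

text \<open>The description is symmetric in the two endpoints, so it determines a unique number on every
  unordered pair (lemma \<open>edge_label_pair\<close>).\<close>

definition edge_label :: "('a \<Rightarrow> nat) \<Rightarrow> 'a set \<Rightarrow> nat" where
  "edge_label f e = (THE d. \<exists>u v. e = {u, v} \<and> d = nat \<bar>int (f u) - int (f v)\<bar>)"

lemma edge_label_pair: "edge_label f {u, v} = nat \<bar>int (f u) - int (f v)\<bar>"
  unfolding edge_label_def by (rule the_equality) (auto simp: doubleton_eq_iff)

definition graceful_labelling :: "'a ugraph \<Rightarrow> ('a \<Rightarrow> nat) \<Rightarrow> bool" where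
  "graceful_labelling G f \<longleftrightarrow>
     (let m = card (edges G) in
       inj_on f (verts G) \<and> f ` verts G \<subseteq> {0..m} \<and>
       bij_betw (edge_label f) (edges G) {1..m})"

definition near_graceful_labelling :: "'a ugraph \<Rightarrow> ('a \<Rightarrow> nat) \<Rightarrow> bool" where
  "near_graceful_labelling G f \<longleftrightarrow>
     (let m = card (edges G) in
       inj_on f (verts G) \<and> f ` verts G \<subseteq> {0..m + 1} \<and>
       (\<exists>A. (A = {1..m} \<or> A = {1..m - 1} \<union> {m + 1}) \<and>
            bij_betw (edge_label f) (edges G) A))"

definition graceful :: "'a ugraph \<Rightarrow> bool" where
  "graceful G \<longleftrightarrow> (\<exists>f. graceful_labelling G f)"

definition near_graceful :: "'a ugraph \<Rightarrow> bool" where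
  "near_graceful G \<longleftrightarrow> (\<exists>f. near_graceful_labelling G f)"

text \<open>The \<open>i\<close>-th cycle (\<open>i < p\<close>) passes through \<open>Center, Outer i 1, \<dots>, Outer i (n - 1)\<close> in this
  order and back to \<open>Center\<close>; positions on it are read modulo \<open>n\<close>. The construction yields
  simple cycles of length \<open>n\<close> for \<open>n \<ge> 3\<close>.\<close>

datatype cvertex = Center | Outer nat nat

definition cycle_vertex :: "nat \<Rightarrow> nat \<Rightarrow> nat \<Rightarrow> cvertex" where
  "cycle_vertex n i j = (if j mod n = 0 then Center else Outer i (j mod n))"

definition cycle_graph :: "nat \<Rightarrow> nat \<Rightarrow> cvertex ugraph" where
  "cycle_graph n i =
     ({cycle_vertex n i j | j. j < n},
      {{cycle_vertex n i j, cycle_vertex n i (Suc j)} | j. j < n})"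

definition cycles_at_vertex :: "nat \<Rightarrow> nat \<Rightarrow> cvertex ugraph" where
  "cycles_at_vertex n p =
     (\<Union>i<p. verts (cycle_graph n i), \<Union>i<p. edges (cycle_graph n i))"

lemma cycles_share_only_Center:
  assumes "n > 0" "i \<noteq> i'"
  shows "verts (cycle_graph n i) \<inter> verts (cycle_graph n i') = {Center}"
proof -
  have "cycle_vertex n k 0 = Center" for k by (simp add: cycle_vertex_def)
  then have "Center \<in> verts (cycle_graph n k)" for k
    using assms(1) unfolding cycle_graph_def by (force intro: exI[of _ 0])
  moreover have "x = Center" if "x \<in> verts (cycle_graph n i)" "x \<in> verts (cycle_graph n i')" for x
    using that assms(2) by (auto simp: cycle_graph_def cycle_vertex_def split: if_splits)
  ultimately show ?thesis by blast
qed

lemma card_edges_cycles_at_vertex: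
  assumes "n \<ge> 3"
  shows "card (edges (cycles_at_vertex n p)) = n * p"
proof -
  let ?e = "\<lambda>(i, j). {cycle_vertex n i j, cycle_vertex n i (Suc j)}"
  have "edges (cycles_at_vertex n p) = ?e ` ({..<p} \<times> {..<n})"
    by (auto simp: cycles_at_vertex_def cycle_graph_def)
  moreover have "inj_on ?e ({..<p} \<times> {..<n})"
    using assms
    by (auto simp: inj_on_def cycle_vertex_def mod_Suc doubleton_eq_iff split: if_splits)
  ultimately show ?thesis by (simp add: card_image mult.commute)
qed

end

theory Submission
  imports Defs
begin

text \<open>
  A Skolem sequence of order \<open>n\<close> places the numbers \<open>1, \<dots>, n\<close> twice each at the positions
  \<open>1, \<dots>, 2n\<close> so that the two copies of \<open>d\<close> are at distance \<open>d\<close>. Give the center the label \<open>0\<close>. A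
  Skolem sequence of order \<open>p\<close> splits \<open>{1, \<dots>, 2p}\<close> into pairs \<open>(v\<^sub>i, u\<^sub>i)\<close> with
  \<open>u\<^sub>i - v\<^sub>i = i\<close>; these label the middle edges. All the \<open>u\<^sub>i\<close> and \<open>v\<^sub>i\<close> together are in turn the
  differences of a Skolem sequence of order \<open>2p\<close>, shifted to the positions \<open>p + 1, \<dots>, 5p\<close>. If it
  places \<open>u\<^sub>i\<close> at \<open>x' < x\<close>, then the path from \<open>0\<close> through \<open>x\<close> to \<open>u\<^sub>i\<close> has the edge labels \<open>x\<close> and
  \<open>x - u\<^sub>i = x'\<close>, and likewise for \<open>v\<^sub>i\<close>. So the edge labels are exactly \<open>1, \<dots>, 5p\<close>, and the vertex
  labels are distinct if no right end of the long sequence is one of the \<open>u\<^sub>i, v\<^sub>i\<close>.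

  Skolem sequences of order \<open>n\<close> exist only for \<open>n \<equiv> 0, 1 (mod 4)\<close>. Otherwise a hooked sequence,
  on \<open>{1, \<dots>, 2n - 1, 2n + 1}\<close>, takes their place. When the short sequence is hooked, the
  differences of the long one are \<open>1, \<dots>, 2p - 1, 2p + 1\<close>, which reverses the parity condition that
  decides whether it needs a hook. When the long one is hooked, the
  labelling is only near graceful.
\<close>

text \<open>
  \<open>a d\<close> is the left position of the pair with difference \<open>d\<close>. Covering all of \<open>P\<close> is not required:
  a count of the edges yields it.
\<close>

definition langford_pairs :: "nat set \<Rightarrow> nat set \<Rightarrow> (nat \<Rightarrow> nat) \<Rightarrow> bool" where
  "langford_pairs D P a \<longleftrightarrow>
     (\<forall>d\<in>D. a d \<in> P \<and> a d + d \<in> P) \<and>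
     (\<forall>d\<in>D. \<forall>e\<in>D. (a d = a e \<longrightarrow> d = e) \<and> (a d + d = a e + e \<longrightarrow> d = e) \<and> a d \<noteq> a e + e)"

lemma langford_pairsI:
  assumes "\<And>d. d \<in> D \<Longrightarrow> a d \<in> P" "\<And>d. d \<in> D \<Longrightarrow> a d + d \<in> P"
    and "\<And>d e. d \<in> D \<Longrightarrow> e \<in> D \<Longrightarrow> a d = a e \<Longrightarrow> d = e"
    and "\<And>d e. d \<in> D \<Longrightarrow> e \<in> D \<Longrightarrow> a d + d = a e + e \<Longrightarrow> d = e"
    and "\<And>d e. d \<in> D \<Longrightarrow> e \<in> D \<Longrightarrow> a d \<noteq> a e + e"
  shows "langford_pairs D P a"
  using assms unfolding langford_pairs_def by blast

section \<open>Labelling the cycles from two difference sequences\<close>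

fun C5_label :: "nat \<Rightarrow> (nat \<Rightarrow> nat) \<Rightarrow> (nat \<Rightarrow> nat) \<Rightarrow> cvertex \<Rightarrow> nat" where
  "C5_label p a c Center = 0"
| "C5_label p a c (Outer i j) =
     (let v = a (Suc i); u = v + Suc i in
      if j = 1 then p + (c u + u) else if j = 2 then u else if j = 3 then v else p + (c v + v))"

lemma verts_C5:
  "verts (cycles_at_vertex 5 p) \<subseteq> insert Center ((\<lambda>(i, j). Outer i j) ` ({..<p} \<times> {1, 2, 3, 4}))"
proof -
  have "j = 0 \<or> j = 1 \<or> j = 2 \<or> j = 3 \<or> j = 4" if "j < 5" for j :: nat
    using that by arith
  then show ?thesis
    by (fastforce simp: cycles_at_vertex_def cycle_graph_def cycle_vertex_def)
qed

text \<open>Surjectivity comes from counting: the \<open>5 * p\<close> edge labels are distinct and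
  lie in a set of that size. Arbitrary \<open>U\<close> and \<open>Q\<close> cover sequences with
  and without a hook at once.\<close>

lemma C5_labelling:
  assumes a: "langford_pairs {1..p} U a" and c: "langford_pairs U Q c"
    and "0 \<notin> U" "0 \<notin> Q" and avoid: "\<And>d. d \<in> U \<Longrightarrow> p + (c d + d) \<notin> U"
    and card_A: "card ({1..p} \<union> (+) p ` Q) = 5 * p" and "finite Q"
  defines "f \<equiv> C5_label p a c"
  shows "inj_on f (verts (cycles_at_vertex 5 p))"
    and "f ` verts (cycles_at_vertex 5 p) \<subseteq> insert 0 (U \<union> (+) p ` Q)"
    and "bij_betw (edge_label f) (edges (cycles_at_vertex 5 p)) ({1..p} \<union> (+) p ` Q)"
proof -
  let ?G = "cycles_at_vertex 5 p" and ?A = "{1..p} \<union> (+) p ` Q"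
  define v where "v i = a (Suc i)" for i
  define u where "u i = a (Suc i) + Suc i" for i
  have vU: "v i \<in> U" and uU: "u i \<in> U" if "i < p" for i
  proof -
    have "Suc i \<in> {1..p}" using that by auto
    then show "v i \<in> U" "u i \<in> U"
      using a unfolding langford_pairs_def v_def u_def by blast+
  qed
  have vv: "v i = v i' \<longleftrightarrow> i = i'" and uu: "u i = u i' \<longleftrightarrow> i = i'" and vu: "v i \<noteq> u i'" "u i' \<noteq> v i"
    if "i < p" "i' < p" for i i'
  proof -
    have "Suc i \<in> {1..p}" "Suc i' \<in> {1..p}" using that by auto
    then show "v i = v i' \<longleftrightarrow> i = i'" "u i = u i' \<longleftrightarrow> i = i'" "v i \<noteq> u i'" "u i' \<noteq> v i"
      using a unfolding langford_pairs_def v_def u_def by (metis Suc_inject)+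
  qed
  have cQ: "c d \<in> Q" "c d + d \<in> Q" if "d \<in> U" for d
    using c that unfolding langford_pairs_def by auto
  have ci: "c d = c e \<longleftrightarrow> d = e" "c d + d = c e + e \<longleftrightarrow> d = e" "c d \<noteq> c e + e" "c e + e \<noteq> c d"
    if "d \<in> U" "e \<in> U" for d e
    using c that unfolding langford_pairs_def by metis+
  have pos: "d > 0" if "d \<in> U" for d using that \<open>0 \<notin> U\<close> by (cases d) auto
  have Qpos: "d > 0" if "d \<in> Q" for d using that \<open>0 \<notin> Q\<close> by (cases d) auto
  have av: "p + (c d + d) \<noteq> d'" "d' \<noteq> p + (c d + d)" if "d \<in> U" "d' \<in> U" for d d'
    using avoid[OF that(1)] that(2) by auto
  \<comment> \<open>Positions in \<open>Q\<close> are positive, so the shift by \<open>p\<close>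
    puts all other edge labels above those of the middle edges.\<close>
  have lo: "Suc i \<noteq> p + c d" "Suc i \<noteq> p + (c d + d)" "p + c d \<noteq> Suc i" "p + (c d + d) \<noteq> Suc i"
    if "i < p" "d \<in> U" for i d
    using that Qpos[OF cQ(1)[OF that(2)]] by auto
  have f_simps: "f Center = 0" "f (Outer i 1) = p + (c (u i) + u i)" "f (Outer i 2) = u i"
    "f (Outer i 3) = v i" "f (Outer i 4) = p + (c (v i) + v i)" for i
    by (simp_all add: f_def u_def v_def Let_def)
  note f_simps = f_simps f_simps(2)[unfolded One_nat_def] f_simps(3)[unfolded numeral_2_eq_2]
  have "inj_on f (insert Center ((\<lambda>(i, j). Outer i j) ` ({..<p} \<times> {1, 2, 3, 4})))"
    unfolding inj_on_def
    by (auto simp: f_simps vv uu vu vU uU ci av pos[OF vU] pos[OF uU])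
  then show "inj_on f (verts ?G)"
    by (rule inj_on_subset) (rule verts_C5)
  have "f ` insert Center ((\<lambda>(i, j). Outer i j) ` ({..<p} \<times> {1, 2, 3, 4})) \<subseteq> insert 0 (U \<union> (+) p ` Q)"
    by (auto simp: f_simps vU uU cQ)
  then show "f ` verts ?G \<subseteq> insert 0 (U \<union> (+) p ` Q)"
    using image_mono[OF verts_C5] by (rule subset_trans[rotated])
  define e where "e = (\<lambda>(i, j). {cycle_vertex 5 i j, cycle_vertex 5 i (Suc j)})"
  have edges: "edges ?G = e ` ({..<p} \<times> {..<5})"
    by (auto simp: cycles_at_vertex_def cycle_graph_def e_def)
  have five: "{..<5} = {0, 1, 2, 3, 4 :: nat}" by auto
  have lab: "edge_label f (e (i, 0)) = p + (c (u i) + u i)" "edge_label f (e (i, 1)) = p + c (u i)"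
    "edge_label f (e (i, 2)) = Suc i" "edge_label f (e (i, 3)) = p + c (v i)"
    "edge_label f (e (i, 4)) = p + (c (v i) + v i)" for i
    by (simp_all add: e_def edge_label_pair cycle_vertex_def f_simps) (simp_all add: u_def v_def)
  note lab = lab lab(2)[unfolded One_nat_def]
  have inj: "inj_on (\<lambda>x. edge_label f (e x)) ({..<p} \<times> {..<5})"
    unfolding five inj_on_def
    by (auto simp: lab vv uu vu vU uU ci lo)
  have "edge_label f ` edges ?G \<subseteq> ?A"
    unfolding edges five by (auto simp: lab cQ vU uU)
  moreover have "card (edge_label f ` edges ?G) = 5 * p"
    using card_image[OF inj] by (simp add: edges image_image)
  moreover have "finite (edges ?G)" unfolding edges by simp
  ultimately show "bij_betw (edge_label f) (edges ?G) ?A"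
    using card_A card_edges_cycles_at_vertex[of 5 p] \<open>finite Q\<close>
    by (simp add: bij_betw_def eq_card_imp_inj_on card_subset_eq)
qed

lemma graceful_C5I:
  assumes a: "langford_pairs {1..p} U a" and c: "langford_pairs U {1..4 * p} c"
    and U: "U \<subseteq> {1..5 * p}" and avoid: "\<And>d. d \<in> U \<Longrightarrow> p + (c d + d) \<notin> U"
  shows "graceful (cycles_at_vertex 5 p)"
proof -
  have img: "(+) p ` {1..4 * p} = {p + 1..5 * p}"
    by simp
  have A: "{1..p} \<union> (+) p ` {1..4 * p} = {1..5 * p}"
    unfolding img by auto
  have side: "0 \<notin> U" "0 \<notin> {1..4 * p}" "card ({1..p} \<union> (+) p ` {1..4 * p}) = 5 * p" "finite {1..4 * p}"
    unfolding A using U by auto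
  note L = C5_labelling[OF a c side(1,2) avoid side(3,4)]
  have "insert 0 (U \<union> (+) p ` {1..4 * p}) \<subseteq> {0..5 * p}"
    using U unfolding img by auto
  then have "graceful_labelling (cycles_at_vertex 5 p) (C5_label p a c)"
    using L(1,3) subset_trans[OF L(2)] card_edges_cycles_at_vertex[of 5 p]
    by (simp only: graceful_labelling_def Let_def A)
  then show ?thesis
    unfolding graceful_def by blast
qed

text \<open>The hook moves the largest edge label from \<open>5 * p\<close> to
  \<open>5 * p + 1\<close>, which is the second range that near gracefulness allows.\<close>

lemma near_graceful_C5I:
  assumes a: "langford_pairs {1..p} U a"
    and c: "langford_pairs U ({1..4 * p - 1} \<union> {4 * p + 1}) c" (is "langford_pairs U ?Q c")
    and U: "U \<subseteq> {1..5 * p}" and "p \<ge> 1" and avoid: "\<And>d. d \<in> U \<Longrightarrow> p + (c d + d) \<notin> U"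
  shows "near_graceful (cycles_at_vertex 5 p)"
proof -
  have img: "(+) p ` ?Q = {p + 1..5 * p - 1} \<union> {5 * p + 1}"
    using \<open>p \<ge> 1\<close> by (simp add: image_Un)
  have A: "{1..p} \<union> (+) p ` ?Q = {1..5 * p - 1} \<union> {5 * p + 1}"
    unfolding img using \<open>p \<ge> 1\<close> by auto
  have side: "0 \<notin> U" "0 \<notin> ?Q" "card ({1..p} \<union> (+) p ` ?Q) = 5 * p" "finite ?Q"
    unfolding A using U \<open>p \<ge> 1\<close> by (auto simp: card_Un_disjoint)
  note L = C5_labelling[OF a c side(1,2) avoid side(3,4)]
  have "insert 0 (U \<union> (+) p ` ?Q) \<subseteq> {0..5 * p + 1}"
    using U unfolding img by auto
  then have "near_graceful_labelling (cycles_at_vertex 5 p) (C5_label p a c)"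
    using L(1,3) subset_trans[OF L(2)] card_edges_cycles_at_vertex[of 5 p]
    by (simp only: near_graceful_labelling_def Let_def A) blast
  then show ?thesis
    unfolding near_graceful_def by blast
qed

section \<open>Explicit sequences and their right ends\<close>

text \<open>
  In each sequence below the even differences form one nest of concentric pairs and the odd ones two,
  one of the short and one of the long differences, apart from a few exceptional pairs.
  For \<open>skolem0\<close>, \<open>skolem1\<close>, \<open>hooked2\<close> and \<open>hooked3\<close> these are the classical constructions, of order
  \<open>4s\<close>, \<open>4t + 1\<close>, \<open>4s + 2\<close> and \<open>4t - 1\<close>; \<open>skolem0\<close> is reversed, because then the even nest comes
  first and all right ends lie beyond \<open>2s\<close>.
\<close>

definition skolem0 :: "nat \<Rightarrow> nat \<Rightarrow> nat" where
  "skolem0 s d =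
     (if even d then 2 * s + 1 - d div 2
      else if d = 1 then 7 * s
      else if d + 1 = 2 * s then 4 * s + 2
      else if d + 1 = 4 * s then 2 * s + 1
      else if d < 2 * s then 6 * s - d div 2
      else 6 * s + 1 - d div 2)"

text \<open>Free of \<open>div\<close> and subtraction, every branch is a linear fact, so each pair
  of branches can be settled by linear arithmetic. The later sequences are treated in the same
  way.\<close>

lemma skolem0_cases:
  assumes "s \<ge> 2" "d \<in> {1..4 * s}"
  shows "\<exists>k. d = 2 * k \<and> 1 \<le> k \<and> k \<le> 2 * s \<and> skolem0 s d + k = 2 * s + 1 \<or>
    d = 1 \<and> skolem0 s d = 7 * s \<or>
    d + 1 = 2 * s \<and> skolem0 s d = 4 * s + 2 \<or>
    d + 1 = 4 * s \<and> skolem0 s d = 2 * s + 1 \<or>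
    d = 2 * k + 1 \<and> 1 \<le> k \<and> k + 2 \<le> s \<and> skolem0 s d + k = 6 * s \<or>
    d = 2 * k + 1 \<and> s \<le> k \<and> k + 2 \<le> 2 * s \<and> skolem0 s d + k = 6 * s + 1"
proof (cases "even d")
  case True
  then obtain k where "d = 2 * k" by (rule evenE)
  then show ?thesis
    using assms by (intro exI[of _ k]) (simp add: skolem0_def; presburger)
next
  case False
  then obtain k where "d = 2 * k + 1" by (rule oddE)
  then show ?thesis
    using assms by (intro exI[of _ k]) (simp add: skolem0_def; presburger)
qed

lemma skolem0_pairs:
  assumes "s \<ge> 2"
  shows "langford_pairs {1..4 * s} {1..8 * s} (skolem0 s)"
proof (rule langford_pairsI)
  fix d e assume D: "d \<in> {1..4 * s}" "e \<in> {1..4 * s}"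
  note C = skolem0_cases[OF assms D(1)] skolem0_cases[OF assms D(2)]
  show "skolem0 s d = skolem0 s e \<Longrightarrow> d = e"
    using C assms by (elim exE disjE conjE; linarith)
  show "skolem0 s d + d = skolem0 s e + e \<Longrightarrow> d = e"
    using C assms by (elim exE disjE conjE; linarith)
  show "skolem0 s d \<noteq> skolem0 s e + e"
    using C assms by (elim exE disjE conjE; linarith)
next
  fix d assume D: "d \<in> {1..4 * s}"
  show "skolem0 s d \<in> {1..8 * s}" "skolem0 s d + d \<in> {1..8 * s}"
    using skolem0_cases[OF assms D] assms unfolding Un_iff atLeastAtMost_iff singleton_iff
    by (elim exE disjE conjE; linarith)+
qed

text \<open>Here \<open>p = 2 * s\<close>, so right ends beyond \<open>2 * s\<close> are shifted
  past the largest difference \<open>4 * s\<close>.\<close>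

lemma skolem0_avoids:
  assumes "s \<ge> 2" "d \<in> {1..4 * s}"
  shows "2 * s + (skolem0 s d + d) \<notin> {1..4 * s}"
  using skolem0_cases[OF assms] assms unfolding Un_iff atLeastAtMost_iff singleton_iff
  by (elim exE disjE conjE; linarith)

definition skolem1 :: "nat \<Rightarrow> nat \<Rightarrow> nat" where
  "skolem1 t d =
     (if even d then 6 * t + 2 - d div 2
      else if d = 4 * t + 1 then 2 * t + 1
      else if d = 1 then t + 1
      else if d + 1 = 2 * t then 2 * t + 2
      else if d < 2 * t then 2 * t + 1 - d div 2
      else 2 * t - d div 2)"

lemma skolem1_cases:
  assumes "t \<ge> 2" "d \<in> {1..4 * t + 1}"
  shows "\<exists>k. d = 2 * k \<and> 1 \<le> k \<and> k \<le> 2 * t \<and> skolem1 t d + k = 6 * t + 2 \<or>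
    d = 4 * t + 1 \<and> skolem1 t d = 2 * t + 1 \<or>
    d = 1 \<and> skolem1 t d = t + 1 \<or>
    d + 1 = 2 * t \<and> skolem1 t d = 2 * t + 2 \<or>
    d = 2 * k + 1 \<and> 1 \<le> k \<and> k + 2 \<le> t \<and> skolem1 t d + k = 2 * t + 1 \<or>
    d = 2 * k + 1 \<and> t \<le> k \<and> k + 1 \<le> 2 * t \<and> skolem1 t d + k = 2 * t"
proof (cases "even d")
  case True
  then obtain k where "d = 2 * k" by (rule evenE)
  then show ?thesis
    using assms by (intro exI[of _ k]) (simp add: skolem1_def; presburger)
next
  case False
  then obtain k where "d = 2 * k + 1" by (rule oddE)
  then show ?thesis
    using assms by (intro exI[of _ k]) (simp add: skolem1_def; presburger)
qed

lemma skolem1_pairs: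
  assumes "t \<ge> 2"
  shows "langford_pairs {1..4 * t + 1} {1..8 * t + 2} (skolem1 t)"
proof (rule langford_pairsI)
  fix d e assume D: "d \<in> {1..4 * t + 1}" "e \<in> {1..4 * t + 1}"
  note C = skolem1_cases[OF assms D(1)] skolem1_cases[OF assms D(2)]
  show "skolem1 t d = skolem1 t e \<Longrightarrow> d = e"
    using C assms by (elim exE disjE conjE; linarith)
  show "skolem1 t d + d = skolem1 t e + e \<Longrightarrow> d = e"
    using C assms by (elim exE disjE conjE; linarith)
  show "skolem1 t d \<noteq> skolem1 t e + e"
    using C assms by (elim exE disjE conjE; linarith)
next
  fix d assume D: "d \<in> {1..4 * t + 1}"
  show "skolem1 t d \<in> {1..8 * t + 2}" "skolem1 t d + d \<in> {1..8 * t + 2}"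
    using skolem1_cases[OF assms D] assms unfolding Un_iff atLeastAtMost_iff singleton_iff
    by (elim exE disjE conjE; linarith)+
qed

definition hooked2 :: "nat \<Rightarrow> nat \<Rightarrow> nat" where
  "hooked2 s d =
     (if d = 4 * s + 1 then 2 * s + 1
      else if d = 4 * s + 2 then 4 * s + 3
      else if even d then 2 * s + 1 - d div 2
      else if d = 2 * s + 1 then 4 * s + 2
      else if d = 1 then 7 * s + 3
      else if d < 2 * s then 6 * s + 2 - d div 2
      else 6 * s + 3 - d div 2)"

lemma hooked2_cases:
  assumes "d \<in> {1..4 * s + 2}"
  shows "\<exists>k. d = 4 * s + 1 \<and> hooked2 s d = 2 * s + 1 \<or>
    d = 4 * s + 2 \<and> hooked2 s d = 4 * s + 3 \<or>
    d = 2 * k \<and> 1 \<le> k \<and> k \<le> 2 * s \<and> hooked2 s d + k = 2 * s + 1 \<or>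
    d = 2 * s + 1 \<and> s > 0 \<and> hooked2 s d = 4 * s + 2 \<or>
    d = 1 \<and> s > 0 \<and> hooked2 s d = 7 * s + 3 \<or>
    d = 2 * k + 1 \<and> 1 \<le> k \<and> k + 1 \<le> s \<and> hooked2 s d + k = 6 * s + 2 \<or>
    d = 2 * k + 1 \<and> s + 1 \<le> k \<and> k + 1 \<le> 2 * s \<and> hooked2 s d + k = 6 * s + 3"
proof (cases "even d")
  case True
  then obtain k where "d = 2 * k" by (rule evenE)
  then show ?thesis
    using assms by (intro exI[of _ k]) (simp add: hooked2_def; presburger)
next
  case False
  then obtain k where "d = 2 * k + 1" by (rule oddE)
  then show ?thesis
    using assms by (intro exI[of _ k]) (simp add: hooked2_def; presburger)
qed

lemma hooked2_pairs: "langford_pairs {1..4 * s + 2} ({1..8 * s + 3} \<union> {8 * s + 5}) (hooked2 s)"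
proof (rule langford_pairsI)
  fix d e assume D: "d \<in> {1..4 * s + 2}" "e \<in> {1..4 * s + 2}"
  note C = hooked2_cases[OF D(1)] hooked2_cases[OF D(2)]
  have odd: "2 * s \<noteq> 1" by presburger
  show "hooked2 s d = hooked2 s e \<Longrightarrow> d = e"
    using C odd by (elim exE disjE conjE; linarith)
  show "hooked2 s d + d = hooked2 s e + e \<Longrightarrow> d = e"
    using C odd by (elim exE disjE conjE; linarith)
  show "hooked2 s d \<noteq> hooked2 s e + e"
    using C odd by (elim exE disjE conjE; linarith)
next
  fix d assume D: "d \<in> {1..4 * s + 2}"
  show "hooked2 s d \<in> {1..8 * s + 3} \<union> {8 * s + 5}" "hooked2 s d + d \<in> {1..8 * s + 3} \<union> {8 * s + 5}"
    using hooked2_cases[OF D] unfolding Un_iff atLeastAtMost_iff singleton_iff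
    by (elim exE disjE conjE; linarith)+
qed

lemma hooked2_avoids:
  assumes "d \<in> {1..4 * s + 2}"
  shows "2 * s + 1 + (hooked2 s d + d) \<notin> {1..4 * s + 2}"
  using hooked2_cases[OF assms] assms unfolding Un_iff atLeastAtMost_iff singleton_iff
  by (elim exE disjE conjE; linarith)

definition hooked3 :: "nat \<Rightarrow> nat \<Rightarrow> nat" where
  "hooked3 t d =
     (if d + 2 = 4 * t then 2 * t + 1
      else if even d then 6 * t - 1 - d div 2
      else if d + 1 = 4 * t then 4 * t
      else if d = 1 then t
      else if d + 1 = 2 * t then 2 * t
      else if d < 2 * t then 2 * t - d div 2
      else 2 * t - 1 - d div 2)"

lemma hooked3_cases:
  assumes "t \<ge> 2" "d \<in> {1..4 * t - 1}"
  shows "\<exists>k. d + 2 = 4 * t \<and> hooked3 t d = 2 * t + 1 \<or>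
    d = 2 * k \<and> 1 \<le> k \<and> k + 2 \<le> 2 * t \<and> hooked3 t d + k + 1 = 6 * t \<or>
    d + 1 = 4 * t \<and> hooked3 t d = 4 * t \<or>
    d = 1 \<and> hooked3 t d = t \<or>
    d + 1 = 2 * t \<and> hooked3 t d = 2 * t \<or>
    d = 2 * k + 1 \<and> 1 \<le> k \<and> k + 2 \<le> t \<and> hooked3 t d + k = 2 * t \<or>
    d = 2 * k + 1 \<and> t \<le> k \<and> k + 2 \<le> 2 * t \<and> hooked3 t d + k + 1 = 2 * t"
proof (cases "even d")
  case True
  then obtain k where "d = 2 * k" by (rule evenE)
  then show ?thesis
    using assms by (intro exI[of _ k]) (simp add: hooked3_def; presburger)
next
  case False
  then obtain k where "d = 2 * k + 1" by (rule oddE)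
  then show ?thesis
    using assms by (intro exI[of _ k]) (simp add: hooked3_def; presburger)
qed

lemma hooked3_pairs:
  assumes "t \<ge> 2"
  shows "langford_pairs {1..4 * t - 1} ({1..8 * t - 3} \<union> {8 * t - 1}) (hooked3 t)"
proof (rule langford_pairsI)
  fix d e assume D: "d \<in> {1..4 * t - 1}" "e \<in> {1..4 * t - 1}"
  note C = hooked3_cases[OF assms D(1)] hooked3_cases[OF assms D(2)]
  show "hooked3 t d = hooked3 t e \<Longrightarrow> d = e"
    using C assms by (elim exE disjE conjE; linarith)
  show "hooked3 t d + d = hooked3 t e + e \<Longrightarrow> d = e"
    using C assms by (elim exE disjE conjE; linarith)
  show "hooked3 t d \<noteq> hooked3 t e + e"
    using C assms by (elim exE disjE conjE; linarith)
next
  fix d assume D: "d \<in> {1..4 * t - 1}"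
  show "hooked3 t d \<in> {1..8 * t - 3} \<union> {8 * t - 1}" "hooked3 t d + d \<in> {1..8 * t - 3} \<union> {8 * t - 1}"
    using hooked3_cases[OF assms D] assms unfolding Un_iff atLeastAtMost_iff singleton_iff
    by (elim exE disjE conjE; linarith)+
qed

text \<open>
  In \<open>gap2\<close> and \<open>gap3\<close> the difference \<open>n\<close> is replaced by \<open>n + 1\<close>, where \<open>n = 4s\<close> and
  \<open>n = 4s + 2\<close> is the order; \<open>gap2\<close> is also hooked. Putting the difference \<open>2\<close> at the end (\<open>gap2\<close>) or
  shifting the even nest by one (\<open>gap3\<close>) keeps the right ends away from the label \<open>n + 1\<close>.
\<close>

definition gap2 :: "nat \<Rightarrow> nat \<Rightarrow> nat" where
  "gap2 s d =
     (if d = 2 then 8 * s - 1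
      else if even d then 2 * s - d div 2
      else if d = 2 * s + 1 then 2 * s - 1
      else if d = 4 * s + 1 then 2 * s
      else if d div 2 + 1 = 2 * s then 2 * s + 1
      else if d = 1 then 5 * s - 1
      else if d < 2 * s then 6 * s - d div 2
      else 6 * s - 1 - d div 2)"

lemma gap2_cases:
  assumes "s \<ge> 2" "d \<in> {1..4 * s - 1} \<union> {4 * s + 1}"
  shows "\<exists>k. d = 2 \<and> gap2 s d + 1 = 8 * s \<or>
    d = 2 * k \<and> 2 \<le> k \<and> k + 1 \<le> 2 * s \<and> gap2 s d + k = 2 * s \<or>
    d = 2 * s + 1 \<and> gap2 s d + 1 = 2 * s \<or>
    d = 4 * s + 1 \<and> gap2 s d = 2 * s \<or>
    d + 1 = 4 * s \<and> gap2 s d = 2 * s + 1 \<or>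
    d = 1 \<and> gap2 s d + 1 = 5 * s \<or>
    d = 2 * k + 1 \<and> 1 \<le> k \<and> k + 1 \<le> s \<and> gap2 s d + k = 6 * s \<or>
    d = 2 * k + 1 \<and> s + 1 \<le> k \<and> k + 2 \<le> 2 * s \<and> gap2 s d + k + 1 = 6 * s"
proof (cases "even d")
  case True
  then obtain k where "d = 2 * k" by (rule evenE)
  then show ?thesis
    using assms by (intro exI[of _ k]) (simp add: gap2_def; presburger)
next
  case False
  then obtain k where "d = 2 * k + 1" by (rule oddE)
  then show ?thesis
    using assms by (intro exI[of _ k]) (auto simp: gap2_def)
qed

lemma gap2_pairs:
  assumes "s \<ge> 2"
  shows "langford_pairs ({1..4 * s - 1} \<union> {4 * s + 1}) ({1..8 * s - 1} \<union> {8 * s + 1}) (gap2 s)"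
proof (rule langford_pairsI)
  fix d e assume D: "d \<in> {1..4 * s - 1} \<union> {4 * s + 1}" "e \<in> {1..4 * s - 1} \<union> {4 * s + 1}"
  note C = gap2_cases[OF assms D(1)] gap2_cases[OF assms D(2)]
  show "gap2 s d = gap2 s e \<Longrightarrow> d = e"
    using C assms by (elim exE disjE conjE; linarith)
  show "gap2 s d + d = gap2 s e + e \<Longrightarrow> d = e"
    using C assms by (elim exE disjE conjE; linarith)
  show "gap2 s d \<noteq> gap2 s e + e"
    using C assms by (elim exE disjE conjE; linarith)
next
  fix d assume D: "d \<in> {1..4 * s - 1} \<union> {4 * s + 1}"
  show "gap2 s d \<in> {1..8 * s - 1} \<union> {8 * s + 1}" "gap2 s d + d \<in> {1..8 * s - 1} \<union> {8 * s + 1}"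
    using gap2_cases[OF assms D] assms unfolding Un_iff atLeastAtMost_iff singleton_iff
    by (elim exE disjE conjE; linarith)+
qed

text \<open>In the even nest the difference \<open>2\<close> would end at \<open>2 * s + 1\<close>,
  which the shift by \<open>p = 2 * s\<close> takes to \<open>4 * s + 1\<close>. As placed, all
  right ends are at least \<open>2 * s + 2\<close>.\<close>

lemma gap2_avoids:
  assumes "s \<ge> 2" "d \<in> {1..4 * s - 1} \<union> {4 * s + 1}"
  shows "2 * s + (gap2 s d + d) \<notin> {1..4 * s - 1} \<union> {4 * s + 1}"
  using gap2_cases[OF assms] assms unfolding Un_iff atLeastAtMost_iff singleton_iff
  by (elim exE disjE conjE; linarith)

definition gap3 :: "nat \<Rightarrow> nat \<Rightarrow> nat" where
  "gap3 s d =
     (if even d then 2 * s + 2 - d div 2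
      else if d = 4 * s + 3 then 1
      else if d = 4 * s + 1 then 2 * s + 2
      else if d = 2 * s + 1 then 4 * s + 3
      else if d = 1 then 7 * s + 4
      else if d < 2 * s then 6 * s + 3 - d div 2
      else 6 * s + 4 - d div 2)"

lemma gap3_cases:
  assumes "s \<ge> 1" "d \<in> {1..4 * s + 1} \<union> {4 * s + 3}"
  shows "\<exists>k. d = 2 * k \<and> 1 \<le> k \<and> k \<le> 2 * s \<and> gap3 s d + k = 2 * s + 2 \<or>
    d = 4 * s + 3 \<and> gap3 s d = 1 \<or>
    d = 4 * s + 1 \<and> gap3 s d = 2 * s + 2 \<or>
    d = 2 * s + 1 \<and> gap3 s d = 4 * s + 3 \<or>
    d = 1 \<and> gap3 s d = 7 * s + 4 \<or>
    d = 2 * k + 1 \<and> 1 \<le> k \<and> k + 1 \<le> s \<and> gap3 s d + k = 6 * s + 3 \<or>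
    d = 2 * k + 1 \<and> s + 1 \<le> k \<and> k + 1 \<le> 2 * s \<and> gap3 s d + k = 6 * s + 4"
proof (cases "even d")
  case True
  then obtain k where "d = 2 * k" by (rule evenE)
  then show ?thesis
    using assms by (intro exI[of _ k]) (simp add: gap3_def; presburger)
next
  case False
  then obtain k where "d = 2 * k + 1" by (rule oddE)
  then show ?thesis
    using assms by (intro exI[of _ k]) (simp add: gap3_def; presburger)
qed

lemma gap3_pairs:
  assumes "s \<ge> 1"
  shows "langford_pairs ({1..4 * s + 1} \<union> {4 * s + 3}) {1..8 * s + 4} (gap3 s)"
proof (rule langford_pairsI)
  fix d e assume D: "d \<in> {1..4 * s + 1} \<union> {4 * s + 3}" "e \<in> {1..4 * s + 1} \<union> {4 * s + 3}"
  note C = gap3_cases[OF assms D(1)] gap3_cases[OF assms D(2)]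
  show "gap3 s d = gap3 s e \<Longrightarrow> d = e"
    using C assms by (elim exE disjE conjE; linarith)
  show "gap3 s d + d = gap3 s e + e \<Longrightarrow> d = e"
    using C assms by (elim exE disjE conjE; linarith)
  show "gap3 s d \<noteq> gap3 s e + e"
    using C assms by (elim exE disjE conjE; linarith)
next
  fix d assume D: "d \<in> {1..4 * s + 1} \<union> {4 * s + 3}"
  show "gap3 s d \<in> {1..8 * s + 4}" "gap3 s d + d \<in> {1..8 * s + 4}"
    using gap3_cases[OF assms D] assms unfolding Un_iff atLeastAtMost_iff singleton_iff
    by (elim exE disjE conjE; linarith)+
qed

text \<open>Since the even nest is moved by one, all right ends are at least
  \<open>2 * s + 3\<close>, and the shift by \<open>p = 2 * s + 1\<close> takes them past
  \<open>4 * s + 3\<close>.\<close>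

lemma gap3_avoids:
  assumes "s \<ge> 1" "d \<in> {1..4 * s + 1} \<union> {4 * s + 3}"
  shows "2 * s + 1 + (gap3 s d + d) \<notin> {1..4 * s + 1} \<union> {4 * s + 3}"
  using gap3_cases[OF assms] assms unfolding Un_iff atLeastAtMost_iff singleton_iff
  by (elim exE disjE conjE; linarith)

section \<open>Existence in each residue class, small orders included\<close>

lemma skolem_order_0:
  assumes "t \<ge> 1"
  shows "\<exists>a. langford_pairs {1..4 * t} {1..8 * t} a"
proof (cases "t = 1")
  case True
  \<comment> \<open>The sequence \<open>4 1 1 3 4 2 3 2\<close>.\<close>
  have "langford_pairs {1..4} {1..8}
      (\<lambda>d. if d = 1 then 2 else if d = 2 then 6 else if d = 3 then 4 else 1)"
    by (simp add: langford_pairs_def numeral_eq_Suc atLeastAtMostSuc_conv)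
  with True show ?thesis by auto
next
  case False
  with assms skolem0_pairs[of t] show ?thesis by auto
qed

lemma skolem_order_1: "\<exists>a. langford_pairs {1..4 * t + 1} {1..8 * t + 2} a"
proof -
  consider "t = 0" | "t = 1" | "t \<ge> 2" by linarith
  then show ?thesis
  proof cases
    case 1
    have "langford_pairs {1..1} {1..2} (\<lambda>d. 1)"
      by (simp add: langford_pairs_def numeral_eq_Suc atLeastAtMostSuc_conv)
    moreover have "4 * t + 1 = 1" "8 * t + 2 = 2" using 1 by simp_all
    ultimately show ?thesis by metis
  next
    case 2
    \<comment> \<open>The sequence \<open>1 1 3 4 5 3 2 4 2 5\<close>.\<close>
    have "langford_pairs {1..5} {1..10}
        (\<lambda>d. if d = 1 then 1 else if d = 2 then 7 else if d = 3 then 3 else if d = 4 then 4 else 5)"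
      by (simp add: langford_pairs_def numeral_eq_Suc atLeastAtMostSuc_conv)
    with 2 show ?thesis by auto
  next
    case 3
    with skolem1_pairs[of t] show ?thesis by auto
  qed
qed

lemma hooked_order_3: "\<exists>a. langford_pairs {1..4 * t + 3} ({1..8 * t + 5} \<union> {8 * t + 7}) a"
proof (cases "t = 0")
  case True
  \<comment> \<open>The hooked sequence \<open>3 1 1 3 2 _ 2\<close>.\<close>
  have "langford_pairs {1..3} ({1..5} \<union> {7}) (\<lambda>d. if d = 1 then 2 else if d = 2 then 5 else 1)"
    by (simp add: langford_pairs_def numeral_eq_Suc atLeastAtMostSuc_conv)
  with True show ?thesis by auto
next
  case False
  then have t: "t + 1 \<ge> 2" by simp
  have eqs: "4 * (t + 1) - 1 = 4 * t + 3" "8 * (t + 1) - 3 = 8 * t + 5" "8 * (t + 1) - 1 = 8 * t + 7"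
    by simp_all
  show ?thesis
    using hooked3_pairs[OF t, unfolded eqs] by blast
qed

text \<open>This is the long sequence for \<open>p = 4 * t + 2\<close>. Its order
  \<open>8 * t + 4\<close> is divisible by 4, but the gap in its differences forces a hook.\<close>

lemma gap_order_2:
  "\<exists>c. langford_pairs ({1..8 * t + 3} \<union> {8 * t + 5}) ({1..16 * t + 7} \<union> {16 * t + 9}) c \<and>
     (\<forall>d \<in> {1..8 * t + 3} \<union> {8 * t + 5}. 4 * t + 2 + (c d + d) \<notin> {1..8 * t + 3} \<union> {8 * t + 5})"
proof (cases "t = 0")
  case True
  \<comment> \<open>The sequence \<open>5 3 1 1 3 5 2 _ 2\<close>.\<close>
  define c :: "nat \<Rightarrow> nat"
    where "c d = (if d = 1 then 3 else if d = 2 then 7 else if d = 3 then 2 else 1)" for d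
  have "langford_pairs ({1..3} \<union> {5}) ({1..7} \<union> {9}) c"
    by (simp add: langford_pairs_def c_def numeral_eq_Suc atLeastAtMostSuc_conv)
  moreover have "\<forall>d \<in> {1..3} \<union> {5}. 2 + (c d + d) \<notin> {1..3} \<union> {5}"
    by (simp add: c_def numeral_eq_Suc atLeastAtMostSuc_conv)
  ultimately show ?thesis using True by auto
next
  case False
  have eqs: "4 * (2 * t + 1) - 1 = 8 * t + 3" "4 * (2 * t + 1) + 1 = 8 * t + 5"
    "8 * (2 * t + 1) - 1 = 16 * t + 7" "8 * (2 * t + 1) + 1 = 16 * t + 9" "2 * (2 * t + 1) = 4 * t + 2"
    by simp_all
  have s: "2 * t + 1 \<ge> 2" using False by simp
  show ?thesis
    using gap2_pairs[OF s, unfolded eqs] gap2_avoids[OF s, unfolded eqs] by blast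
qed

theorem theorem3p5:
  fixes p :: nat
  assumes "p \<ge> 1"
  shows "(p mod 4 = 1 \<or> p mod 4 = 2 \<longrightarrow> near_graceful (cycles_at_vertex 5 p)) \<and>
         (p mod 4 = 0 \<or> p mod 4 = 3 \<longrightarrow> graceful (cycles_at_vertex 5 p))"
proof -
  define t where "t = p div 4"
  consider "p = 4 * t" | "p = 4 * t + 1" | "p = 4 * t + 2" | "p = 4 * t + 3"
    unfolding t_def by linarith
  then show ?thesis
  proof cases
    case 1
    with \<open>p \<ge> 1\<close> have "t \<ge> 1" by simp
    then obtain a where a: "langford_pairs {1..4 * t} {1..8 * t} a"
      using skolem_order_0 by blast
    have s: "2 * t \<ge> 2" using \<open>t \<ge> 1\<close> by simp
    have eqs: "4 * (2 * t) = 8 * t" "8 * (2 * t) = 4 * (4 * t)" "2 * (2 * t) = 4 * t" by simp_all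
    have "graceful (cycles_at_vertex 5 (4 * t))"
      by (rule graceful_C5I[OF a skolem0_pairs[OF s, unfolded eqs] _
            skolem0_avoids[OF s, unfolded eqs]]) auto
    with 1 show ?thesis by simp
  next
    case 2
    obtain a where a: "langford_pairs {1..4 * t + 1} {1..8 * t + 2} a"
      using skolem_order_1 by blast
    \<comment> \<open>The long sequence has order \<open>8 * t + 2\<close>, congruent to 2 modulo 4,
      hence the hook.\<close>
    have eqs: "4 * (2 * t) = 8 * t" "8 * (2 * t) + 3 = 4 * (4 * t + 1) - 1"
      "8 * (2 * t) + 5 = 4 * (4 * t + 1) + 1" "2 * (2 * t) = 4 * t"
      by simp_all
    have "near_graceful (cycles_at_vertex 5 (4 * t + 1))"
      by (rule near_graceful_C5I[OF a hooked2_pairs[of "2 * t", unfolded eqs] _ _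
            hooked2_avoids[of _ "2 * t", unfolded eqs]]) auto
    moreover have "p mod 4 = 1" using 2 by presburger
    ultimately show ?thesis using 2 by simp
  next
    case 3
    obtain c where c: "langford_pairs ({1..8 * t + 3} \<union> {8 * t + 5}) ({1..16 * t + 7} \<union> {16 * t + 9}) c"
      and avoid: "\<And>d. d \<in> {1..8 * t + 3} \<union> {8 * t + 5} \<Longrightarrow>
        4 * t + 2 + (c d + d) \<notin> {1..8 * t + 3} \<union> {8 * t + 5}"
      using gap_order_2 by blast
    have P: "{1..4 * (4 * t + 2) - 1} \<union> {4 * (4 * t + 2) + 1} = {1..16 * t + 7} \<union> {16 * t + 9}"
      by (simp add: algebra_simps)
    have "near_graceful (cycles_at_vertex 5 (4 * t + 2))"
      by (rule near_graceful_C5I[OF hooked2_pairs c[folded P] _ _ avoid]) auto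
    moreover have "p mod 4 = 2" using 3 by presburger
    ultimately show ?thesis using 3 by simp
  next
    case 4
    obtain a where a: "langford_pairs {1..4 * t + 3} ({1..8 * t + 5} \<union> {8 * t + 7}) a"
      using hooked_order_3 by blast
    have s: "2 * t + 1 \<ge> 1" by simp
    \<comment> \<open>The long sequence has order \<open>8 * t + 6\<close>; the gap inherited from
      the short hook makes it possible without a hook of its own.\<close>
    have eqs: "4 * (2 * t + 1) + 1 = 8 * t + 5" "4 * (2 * t + 1) + 3 = 8 * t + 7"
      "8 * (2 * t + 1) + 4 = 4 * (4 * t + 3)" "2 * (2 * t + 1) + 1 = 4 * t + 3"
      by simp_all
    have "graceful (cycles_at_vertex 5 (4 * t + 3))"
      by (rule graceful_C5I[OF a gap3_pairs[OF s, unfolded eqs] _ gap3_avoids[OF s, unfolded eqs]]) auto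
    moreover have "p mod 4 = 3" using 4 by presburger
    ultimately show ?thesis using 4 by simp
  qed
qed

end
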